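(* Let $T:[r_0,\infty)\to[1,\infty)$ be a continuous increasing function. Then for all $r\ge r_0$ with $T(r)\ge(\sqrt2+1)^2$, outside a possible exceptional set of linear measure at most $\zeta(2,\sqrt2+1)$, one has $$T\Bigl(r+\frac{1}{T(r)}\Bigr)<\bigl(\sqrt{T(r)}+1\bigr)^2\le 2T(r).$$ Moreover, $\zeta(2,\sqrt2+1)\le 0.52<2$.
   Context: Linear measure means Lebesgue measure on the real line. $\zeta(s,a)=\sum_{n=0}^\infty\frac{1}{(n+a)^s}$, for $a>0$ and $s>1$, is the Hurwitz zeta-function. *)

theory Defs
  imports "HOL-Analysis.Analysis"
begin

definition hurwitz_zeta :: "real \<Rightarrow> real \<Rightarrow> real" where
  "hurwitz_zeta s a = (\<Sum>n. 1 / (real n + a) powr s)"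

lemma summable_hurwitz_zeta:
  assumes "a > 0" and "s > 1"
  shows "summable (\<lambda>n. 1 / (real n + a) powr s)"
proof (rule summable_comparison_test')
  show "summable (\<lambda>n. real n powr (- s))"
    using assms by (simp add: summable_real_powr_iff)
  fix n :: nat
  assume "n \<ge> 1"
  then show "norm (1 / (real n + a) powr s) \<le> real n powr (- s)"
    using assms by (simp add: powr_minus_divide frac_le powr_mono2)
qed

end

theory Submission
  imports Defs "HOL-Real_Asymp.Real_Asymp"
begin

text \<open>
  Put \<open>u = sqrt \<circ> T\<close> and \<open>a = sqrt 2 + 1\<close>. The bound \<open>(u r + 1)\<^sup>2 \<le> 2 * T r\<close> is just \<open>u r \<ge> a\<close>,
  because \<open>a\<close> solves \<open>a + 1 = sqrt 2 * a\<close>. A point \<open>r\<close> with \<open>u r \<ge> a\<close> is bad if \<open>u\<close> gains at least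
  \<open>1\<close> on the interval from \<open>r\<close> to \<open>r + 1 / T r\<close>. Sort the bad points into levels, the level \<open>n\<close>
  consisting of those with \<open>n + a \<le> u r < n + a + 1\<close>. From a bad point \<open>r\<close> of level \<open>n\<close>, a step of
  length \<open>1 / T r \<le> 1 / (n + a)\<^sup>2\<close> leaves the level upwards, and by monotonicity no later point returns to
  it. Hence level \<open>n\<close> has diameter at most \<open>1 / (n + a)\<^sup>2\<close>
  (\<open>bad_level_diameter\<close>) and fits into a closed interval of that length. These lengths sum to
  \<open>\<zeta>(2, a)\<close> (\<open>countable_cover_of_small_diameter\<close>).

  For the numerical bound, compare \<open>1 / x\<^sup>2\<close> with the telescoping
  \<open>1 / (x - 1/2) - 1 / (x + 1/2)\<close>. Applied to the whole series this gives
  \<open>1 / (a - 1/2) \<approx> 0.522\<close>, slightly too much; splitting off the first term \<open>1 / a\<^sup>2\<close> improves the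
  estimate to \<open>1 / a\<^sup>2 + 1 / (a + 1/2) \<approx> 0.515\<close>.
\<close>

section \<open>Bounds for the Hurwitz zeta function at 2\<close>

lemma hurwitz_zeta_2_sums:
  assumes "a > 0"
  shows "(\<lambda>n. 1 / (real n + a)\<^sup>2) sums hurwitz_zeta 2 a"
proof -
  have "(\<lambda>n. 1 / (real n + a) powr 2) sums hurwitz_zeta 2 a"
    unfolding hurwitz_zeta_def
    using summable_hurwitz_zeta[of a 2] assms by (intro summable_sums) auto
  moreover have "(real n + a) powr 2 = (real n + a)\<^sup>2" for n
    using assms by simp
  ultimately show ?thesis by simp
qed

lemma hurwitz_zeta_2_split_first:
  assumes "a > 0"
  shows "hurwitz_zeta 2 a = 1 / a\<^sup>2 + hurwitz_zeta 2 (a + 1)"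
proof -
  have "(\<lambda>n. 1 / (real (Suc n) + a)\<^sup>2) sums hurwitz_zeta 2 (a + 1)"
    using hurwitz_zeta_2_sums[of "a + 1"] assms by (simp add: add_ac)
  then have "(\<lambda>n. 1 / (real n + a)\<^sup>2) sums (hurwitz_zeta 2 (a + 1) + 1 / (real 0 + a)\<^sup>2)"
    by (rule sums_Suc)
  with hurwitz_zeta_2_sums[OF assms] show ?thesis
    using sums_unique2 by fastforce
qed

text \<open>By convexity \<open>1 / x\<^sup>2\<close> lies below its mean over the unit interval centred at \<open>x\<close>, which is
  \<open>1 / (x - 1/2) - 1 / (x + 1/2) = 1 / (x\<^sup>2 - 1/4)\<close>; these means telescope.\<close>

lemma hurwitz_zeta_2_le:
  assumes "a > 1 / 2"
  shows "hurwitz_zeta 2 a \<le> 1 / (a - 1 / 2)"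
proof -
  define g where "g n = 1 / (real n + a - 1 / 2)" for n
  have "g \<longlonglongrightarrow> 0"
    unfolding g_def by real_asymp
  then have tele: "(\<lambda>n. g n - g (Suc n)) sums (g 0 - 0)"
    by (rule telescope_sums')
  have le: "1 / (real n + a)\<^sup>2 \<le> g n - g (Suc n)" for n
  proof -
    define x where "x = real n + a"
    have x: "x > 1 / 2" using assms by (simp add: x_def)
    have "(1 / 2)\<^sup>2 < x\<^sup>2" using x by (intro power_strict_mono) auto
    then have pos: "x\<^sup>2 - 1 / 4 > 0" by (simp add: power2_eq_square)
    have "g n - g (Suc n) = 1 / (x - 1 / 2) - 1 / (x + 1 / 2)"
      by (simp add: g_def x_def algebra_simps)
    also have "\<dots> = 1 / (x\<^sup>2 - 1 / 4)"
      using x pos by (simp add: divide_simps) (simp add: power2_eq_square algebra_simps)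
    also have "\<dots> \<ge> 1 / x\<^sup>2" using pos by (intro frac_le) auto
    finally show ?thesis by (simp add: x_def)
  qed
  have "(\<lambda>n. 1 / (real n + a)\<^sup>2) sums hurwitz_zeta 2 a"
    using assms by (intro hurwitz_zeta_2_sums) simp
  from sums_le[OF le this tele] have "hurwitz_zeta 2 a \<le> g 0 - 0" .
  then show ?thesis by (simp add: g_def)
qed

lemma hurwitz_zeta_2_sqrt2_plus_1_le: "hurwitz_zeta 2 (sqrt 2 + 1) \<le> 0.52"
proof -
  have lo: "sqrt 2 \<ge> 1.41" by (rule real_le_rsqrt) (simp add: power2_eq_square)
  have "sqrt 2 + 1 + 1 = sqrt 2 + (2 :: real)" by simp
  then have "hurwitz_zeta 2 (sqrt 2 + 1) = 1 / (sqrt 2 + 1)\<^sup>2 + hurwitz_zeta 2 (sqrt 2 + 2)"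
    using hurwitz_zeta_2_split_first[of "sqrt 2 + 1"] lo by (simp only:) (simp add: add_pos_pos)
  also have "\<dots> \<le> 1 / (sqrt 2 + 1)\<^sup>2 + 1 / (sqrt 2 + 2 - 1 / 2)"
    using hurwitz_zeta_2_le[of "sqrt 2 + 2"] lo by simp
  also have "\<dots> \<le> 1 / 2.41\<^sup>2 + 1 / 2.91"
    using lo by (intro add_mono divide_left_mono power_mono mult_pos_pos zero_less_power) auto
  also have "\<dots> \<le> 0.52" by (simp add: power2_eq_square)
  finally show ?thesis .
qed

section \<open>Covering the exceptional set\<close>

text \<open>Each \<open>B n\<close> lies in an interval of length \<open>d n\<close> starting at \<open>Inf (B n)\<close>. The union of
  these intervals is measurable whatever the sets \<open>B n\<close> are.\<close>

lemma countable_cover_of_small_diameter: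
  fixes B :: "nat \<Rightarrow> real set"
  assumes diam: "\<And>n r s. r \<in> B n \<Longrightarrow> s \<in> B n \<Longrightarrow> s \<le> r + d n"
    and d: "d sums D" "\<And>n. d n \<ge> 0"
  obtains E where "E \<in> sets lebesgue" "(\<Union>n. B n) \<subseteq> E" "emeasure lebesgue E \<le> ennreal D"
proof
  define I where "I n = {Inf (B n)..Inf (B n) + d n}" for n
  show "(\<Union>n. I n) \<in> sets lebesgue"
    by (intro sets.countable_UN) (auto simp: I_def)
  have "s \<in> I n" if s: "s \<in> B n" for n s
  proof -
    have "bdd_below (B n)"
      using diam[OF _ s] by (intro bdd_belowI[of _ "s - d n"]) (simp add: algebra_simps)
    then have "Inf (B n) \<le> s" using s by (rule cInf_lower[rotated])
    moreover have "s - d n \<le> Inf (B n)"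
      using s diam[OF _ s] by (intro cInf_greatest) (auto simp: algebra_simps)
    ultimately show ?thesis by (simp add: I_def)
  qed
  then show "(\<Union>n. B n) \<subseteq> (\<Union>n. I n)" by blast
  have "emeasure lebesgue (\<Union>n. I n) \<le> (\<Sum>n. emeasure lebesgue (I n))"
    by (intro emeasure_subadditive_countably) (auto simp: I_def)
  also have "\<dots> = (\<Sum>n. ennreal (d n))"
    using d by (simp add: I_def)
  also have "\<dots> = ennreal D"
    using d by (simp add: suminf_ennreal2 sums_iff)
  finally show "emeasure lebesgue (\<Union>n. I n) \<le> ennreal D" .
qed

text \<open>If \<open>s\<close> lay beyond \<open>r + 1 / T r\<close>, monotonicity would give
  \<open>sqrt (T s) \<ge> sqrt (T r) + 1 \<ge> c + 1\<close>, so \<open>s\<close> would have left the level of \<open>r\<close>.\<close>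

lemma bad_level_diameter:
  fixes T :: "real \<Rightarrow> real"
  assumes mono: "mono_on {r0..} T"
    and "c > 0" "r \<ge> r0"
    and r: "c \<le> sqrt (T r)" "(sqrt (T r) + 1)\<^sup>2 \<le> T (r + 1 / T r)"
    and s: "sqrt (T s) < c + 1"
  shows "s \<le> r + 1 / c\<^sup>2"
proof (rule ccontr)
  assume far: "\<not> s \<le> r + 1 / c\<^sup>2"
  have "c\<^sup>2 \<le> T r"
    using r(1) \<open>c > 0\<close> by (metis less_imp_le real_sqrt_ge_0_iff real_sqrt_pow2 order_trans power_mono)
  moreover have c2: "c\<^sup>2 > 0" using \<open>c > 0\<close> by simp
  ultimately have "T r > 0" "1 / T r \<le> 1 / c\<^sup>2"
    by (linarith, intro frac_le, auto)
  moreover from this have "1 / T r \<ge> 0" by simp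
  ultimately have step: "r0 \<le> r + 1 / T r" "r + 1 / T r \<le> s"
    using far \<open>r \<ge> r0\<close> by linarith+
  have "(c + 1)\<^sup>2 \<le> (sqrt (T r) + 1)\<^sup>2"
    using r(1) \<open>c > 0\<close> by (intro power_mono) auto
  also note r(2)
  also have "T (r + 1 / T r) \<le> T s"
    using step by (intro mono_onD[OF mono]) auto
  finally have "c + 1 \<le> sqrt (T s)" by (rule real_le_rsqrt)
  with s show False by simp
qed

lemma sqrt_plus_1_square_le_double:
  assumes "t \<ge> (sqrt 2 + 1)\<^sup>2"
  shows "(sqrt t + 1)\<^sup>2 \<le> 2 * t"
proof -
  have u: "sqrt t \<ge> sqrt 2 + 1" using assms by (rule real_le_rsqrt)
  have "t \<ge> 0" using assms by (meson order_trans zero_le_power2)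
  have "(sqrt 2 - 1) * (sqrt 2 + 1) \<le> (sqrt 2 - 1) * sqrt t"
    using u by (intro mult_left_mono) auto
  then have "sqrt t + 1 \<le> sqrt 2 * sqrt t" by (simp add: algebra_simps)
  then have "(sqrt t + 1)\<^sup>2 \<le> (sqrt 2 * sqrt t)\<^sup>2"
    using \<open>t \<ge> 0\<close> by (intro power_mono) auto
  then show ?thesis using \<open>t \<ge> 0\<close> by (simp add: power_mult_distrib)
qed

theorem mainTheorem2:
  fixes T :: "real \<Rightarrow> real" and r0 :: real
  assumes T_ge: "\<And>r. r \<ge> r0 \<Longrightarrow> T r \<ge> 1"
    and T_cont: "continuous_on {r0..} T"
    and T_mono: "mono_on {r0..} T"
  shows "(\<exists>E \<in> sets lebesgue.
            emeasure lebesgue E \<le> ennreal (hurwitz_zeta 2 (sqrt 2 + 1)) \<and>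
            (\<forall>r \<ge> r0. T r \<ge> (sqrt 2 + 1)\<^sup>2 \<longrightarrow> r \<notin> E \<longrightarrow>
               T (r + 1 / T r) < (sqrt (T r) + 1)\<^sup>2 \<and> (sqrt (T r) + 1)\<^sup>2 \<le> 2 * T r))
         \<and> hurwitz_zeta 2 (sqrt 2 + 1) \<le> 0.52 \<and> (0.52 :: real) < 2"
proof -
  define a :: real where "a = sqrt 2 + 1"
  have a: "a > 0" by (simp add: a_def add_pos_pos)
  define B where "B n = {r. r \<ge> r0 \<and> real n + a \<le> sqrt (T r) \<and> sqrt (T r) < real n + a + 1 \<and>
    (sqrt (T r) + 1)\<^sup>2 \<le> T (r + 1 / T r)}" for n :: nat
  have "s \<le> r + 1 / (real n + a)\<^sup>2" if "r \<in> B n" "s \<in> B n" for n r s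
    using that a by (intro bad_level_diameter[OF T_mono]) (auto simp: B_def)
  then obtain E where E: "E \<in> sets lebesgue" "(\<Union>n. B n) \<subseteq> E"
      "emeasure lebesgue E \<le> ennreal (hurwitz_zeta 2 a)"
    using countable_cover_of_small_diameter[of B "\<lambda>n. 1 / (real n + a)\<^sup>2"]
      hurwitz_zeta_2_sums[OF a] by (metis zero_le_divide_1_iff zero_le_power2)
  have "T (r + 1 / T r) < (sqrt (T r) + 1)\<^sup>2" if r: "r \<ge> r0" "T r \<ge> a\<^sup>2" "r \<notin> E" for r
  proof (rule ccontr)
    assume bad: "\<not> ?thesis"
    define n where "n = nat \<lfloor>sqrt (T r) - a\<rfloor>"
    have "sqrt (T r) - a \<ge> 0" using real_le_rsqrt[OF r(2)] by simp
    then have "real n \<le> sqrt (T r) - a" "sqrt (T r) - a < real n + 1"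
      unfolding n_def by linarith+
    then have "r \<in> B n" using r bad by (simp add: B_def)
    with E(2) r(3) show False by blast
  qed
  with E hurwitz_zeta_2_sqrt2_plus_1_le sqrt_plus_1_square_le_double show ?thesis
    by (intro conjI bexI[of _ E]) (auto simp: a_def)
qed

end
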